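(* Let $W(D_5^{(1)})=\langle s_0,\dots,s_5\rangle$ be the group generated by the following transformations of $(x,y,z,w,t;\alpha_0,\dots,\alpha_5)$, where $\alpha_0+\alpha_1+2\alpha_2+2\alpha_3+\alpha_4+\alpha_5=1$: $$\begin{aligned} s_0&:\ \to \left(x+\tfrac{\alpha_0}{y+t},y,z,w,t;-\alpha_0,\alpha_1,\alpha_2+\alpha_0,\alpha_3,\alpha_4,\alpha_5\right),\\ s_1&:\ \to \left(x+\tfrac{\alpha_1}{y},y,z,w,t;\alpha_0,-\alpha_1,\alpha_2+\alpha_1,\alpha_3,\alpha_4,\alpha_5\right),\\ s_2&:\ \to \left(x,y-\tfrac{\alpha_2}{x-z},z,w+\tfrac{\alpha_2}{x-z},t;\alpha_0+\alpha_2,\alpha_1+\alpha_2,-\alpha_2,\alpha_3+\alpha_2,\alpha_4,\alpha_5\right),\\ s_3&:\ \to \left(x,y,z+\tfrac{\alpha_3}{w},w,t;\alpha_0,\alpha_1,\alpha_2+\alpha_3,-\alpha_3,\alpha_4+\alpha_3,\alpha_5+\alpha_3\right),\\ s_4&:\ \to \left(x,y,z,w-\tfrac{\alpha_4}{z-1},t;\alpha_0,\alpha_1,\alpha_2,\alpha_3+\alpha_4,-\alpha_4,\alpha_5\right),\\ s_5&:\ \to \left(x,y,z,w-\tfrac{\alpha_5}{z},t;\alpha_0,\alpha_1,\alpha_2,\alpha_3+\alpha_5,\alpha_4,-\alpha_5\right). \end{aligned}$$ For the degeneration process given by the change of parameters and variables $$\alpha_0=A_0,\ \alpha_1=A_1,\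 \alpha_2=A_2,\ \alpha_3=A_3,\ \alpha_4=2A_4-\frac1\varepsilon,\ \alpha_5=\frac1\varepsilon,$$ $$t=-\varepsilon T,\quad x=1+\frac{X}{\varepsilon T},\quad y=\varepsilon TY,\quad z=1+\frac{Z}{\varepsilon T},\quad w=\varepsilon TW,$$ one can choose a subgroup $W_{D_5^{(1)}\to B_4^{(1)}}$ of $W(D_5^{(1)})$ such that $W_{D_5^{(1)}\to B_4^{(1)}}$ converges to $W(B_4^{(1)})$ as $\varepsilon\to0$.
   Context: $W(B_4^{(1)})$ denotes the group generated by the following transformations $\sigma_0,\dots,\sigma_4$ of $(X,Y,Z,W,T;A_0,\dots,A_4)$ with $A_0+A_1+2A_2+2A_3+2A_4=1$ (Bäcklund transformations of the system of type $B_4^{(1)}$): $$\begin{aligned} \sigma_0&:\ \to \left(X+\tfrac{A_0}{Y-1},Y,Z,W,T;-A_0,A_1,A_2+A_0,A_3,A_4\right),\\ \sigma_1&:\ \to \left(X+\tfrac{A_1}{Y},Y,Z,W,T;A_0,-A_1,A_2+A_1,A_3,A_4\right),\\ \sigma_2&:\ \to \left(X,Y-\tfrac{A_2}{X-Z},Z,W+\tfrac{A_2}{X-Z},T;A_0+A_2,A_1+A_2,-A_2,A_3+A_2,A_4\right),\\ \sigma_3&:\ \to \left(X,Y,Z+\tfrac{A_3}{W},W,T;A_0,A_1,A_2+A_3,-A_3,A_4+A_3\right),\\ \sigma_4&:\ \to \left(X,Y,Z,W-\tfrac{2A_4}{Z}+\tfrac{T}{Z^2},-T;A_0,A_1,A_2,A_3+2A_4,-A_4\right).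 \end{aligned}$$ Via the change of variables, elements of $W(D_5^{(1)})$ act on $A_0,\dots,A_4,\varepsilon,T,X,Y,Z,W$; here $\varepsilon=1/\alpha_5$ is treated as one of the quantities acted on. "The subgroup converges to $W(B_4^{(1)})$" means that it is generated by elements $S_0,\dots,S_4$ whose induced actions on $A_0,\dots,A_4,X,Y,Z,W,T$ tend, as $\varepsilon\to0$, to the actions of $\sigma_0,\dots,\sigma_4$ respectively. Products are composed as substitutions: $(ss')(f)=s(s'(f))$ for functions $f$. *)

theory Defs
  imports
    Complex_Main
    "HOL-Library.Poly_Mapping"
    "HOL-Library.Option_ord"
    "HOL-Computational_Algebra.Fraction_Field"
    "HOL-Algebra.Bij"
    "HOL-Algebra.Generated_Groups"
begin

section \<open>Rational functions over the complex numbers\<close>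

text \<open>
  Rational functions in the variables \<open>'v\<close>: the fraction field of the polynomial ring, a
  polynomial being a finitely supported map from monomials (exponent vectors) to coefficients.
\<close>

type_synonym 'v cpoly = "('v \<Rightarrow>\<^sub>0 nat) \<Rightarrow>\<^sub>0 complex"
type_synonym 'v ratfun = "'v cpoly fract"

definition var :: "'v::linorder \<Rightarrow> 'v ratfun" where
  "var v = Fract (Poly_Mapping.single (Poly_Mapping.single v 1) 1) 1"

definition const :: "complex \<Rightarrow> 'v::linorder ratfun" where
  "const c = Fract (Poly_Mapping.single 0 c) 1"

definition poly_at :: "('v \<Rightarrow> complex) \<Rightarrow> 'v cpoly \<Rightarrow> complex" where
  "poly_at q p =
     (\<Sum>m\<in>Poly_Mapping.keys p. Poly_Mapping.lookup p m *
        (\<Prod>v\<in>Poly_Mapping.keys m. q v ^ Poly_Mapping.lookup m v))"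

definition regular_at :: "('v::linorder \<Rightarrow> complex) \<Rightarrow> 'v ratfun \<Rightarrow> bool" where
  "regular_at q f \<longleftrightarrow> (\<exists>a b. f = Fract a b \<and> poly_at q b \<noteq> 0)"

text \<open>Meaningful only if \<^term>\<open>regular_at q f\<close>.\<close>

definition value_at :: "('v::linorder \<Rightarrow> complex) \<Rightarrow> 'v ratfun \<Rightarrow> complex" where
  "value_at q f = (THE c. \<exists>a b. f = Fract a b \<and> poly_at q b \<noteq> 0 \<and> c = poly_at q a / poly_at q b)"

text \<open>Isomorphisms of function fields over the complex numbers.\<close>

definition function_field_iso ::
    "('v::linorder ratfun \<Rightarrow> 'w::linorder ratfun) \<Rightarrow> bool" where
  "function_field_iso \<phi> \<longleftrightarrow>
     bij \<phi> \<and> (\<forall>f g. \<phi> (f + g) = \<phi> f + \<phi> g) \<and> (\<forall>f g. \<phi> (f * g) = \<phi> f * \<phi> g) \<and>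
     (\<forall>c. \<phi> (const c) = const c)"

text \<open>
  The isomorphism that sends the members of the list \<open>fs\<close> to the members of \<open>gs\<close>, position by
  position. It is unique whenever \<open>fs\<close> generates the field, as in all uses below.
\<close>

definition iso_sending ::
    "'v::linorder ratfun list \<Rightarrow> 'w::linorder ratfun list \<Rightarrow> 'v ratfun \<Rightarrow> 'w ratfun" where
  "iso_sending fs gs = (THE \<phi>. function_field_iso \<phi> \<and> map \<phi> fs = gs)"


section \<open>The group of type D5\<close>

text \<open>
  The affine relation between the parameters is used to eliminate \<open>\<alpha>\<^sub>0\<close>, so that the function
  field of the space with coordinates \<open>(x, y, z, w, t; \<alpha>\<^sub>0, \<dots>, \<alpha>\<^sub>5)\<close> is purely transcendental on
  the ten variables below.
\<close>

datatype d5var = Vx | Vy | Vz | Vw | Vt | V\<alpha>1 | V\<alpha>2 | V\<alpha>3 | V\<alpha>4 | V\<alpha>5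

text \<open>An arbitrary linear order; the library needs one to know that polynomials form a domain.\<close>

primrec d5idx :: "d5var \<Rightarrow> nat" where
  "d5idx Vx = 0" | "d5idx Vy = 1" | "d5idx Vz = 2" | "d5idx Vw = 3" | "d5idx Vt = 4"
| "d5idx V\<alpha>1 = 5" | "d5idx V\<alpha>2 = 6" | "d5idx V\<alpha>3 = 7" | "d5idx V\<alpha>4 = 8" | "d5idx V\<alpha>5 = 9"

lemma d5idx_inject: "d5idx u = d5idx v \<longleftrightarrow> u = v"
  by (cases u; cases v) simp_all

instantiation d5var :: linorder
begin
definition less_eq_d5var :: "d5var \<Rightarrow> d5var \<Rightarrow> bool" where "less_eq_d5var u v \<longleftrightarrow> d5idx u \<le> d5idx v"
definition less_d5var :: "d5var \<Rightarrow> d5var \<Rightarrow> bool" where "less_d5var u v \<longleftrightarrow> d5idx u < d5idx v"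
instance
  by standard (auto simp: less_eq_d5var_def less_d5var_def d5idx_inject)
end

text \<open>\<open>d5_coords f\<close> is \<open>f x y z w t \<alpha>\<^sub>0 \<alpha>\<^sub>1 \<alpha>\<^sub>2 \<alpha>\<^sub>3 \<alpha>\<^sub>4 \<alpha>\<^sub>5\<close>.\<close>

definition d5_coords where
  "d5_coords f =
     (let \<alpha>\<^sub>1 = var V\<alpha>1; \<alpha>\<^sub>2 = var V\<alpha>2; \<alpha>\<^sub>3 = var V\<alpha>3; \<alpha>\<^sub>4 = var V\<alpha>4; \<alpha>\<^sub>5 = var V\<alpha>5;
          \<alpha>\<^sub>0 = 1 - \<alpha>\<^sub>1 - 2 * \<alpha>\<^sub>2 - 2 * \<alpha>\<^sub>3 - \<alpha>\<^sub>4 - \<alpha>\<^sub>5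
      in f (var Vx) (var Vy) (var Vz) (var Vw) (var Vt) \<alpha>\<^sub>0 \<alpha>\<^sub>1 \<alpha>\<^sub>2 \<alpha>\<^sub>3 \<alpha>\<^sub>4 \<alpha>\<^sub>5)"

definition d5_gens :: "d5var ratfun list" where
  "d5_gens = d5_coords (\<lambda>x y z w t \<alpha>\<^sub>0 \<alpha>\<^sub>1 \<alpha>\<^sub>2 \<alpha>\<^sub>3 \<alpha>\<^sub>4 \<alpha>\<^sub>5. [x, y, z, w, t, \<alpha>\<^sub>0, \<alpha>\<^sub>1, \<alpha>\<^sub>2, \<alpha>\<^sub>3, \<alpha>\<^sub>4, \<alpha>\<^sub>5])"

text \<open>A birational transformation acts on functions by substitution, i.e. as a field automorphism.\<close>

definition d5_transformation where
  "d5_transformation F = (iso_sending d5_gens (d5_coords F) :: d5var ratfun \<Rightarrow> d5var ratfun)"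

definition s\<^sub>0 where
  "s\<^sub>0 = d5_transformation (\<lambda>x y z w t \<alpha>\<^sub>0 \<alpha>\<^sub>1 \<alpha>\<^sub>2 \<alpha>\<^sub>3 \<alpha>\<^sub>4 \<alpha>\<^sub>5.
     [x + \<alpha>\<^sub>0 / (y + t), y, z, w, t, - \<alpha>\<^sub>0, \<alpha>\<^sub>1, \<alpha>\<^sub>2 + \<alpha>\<^sub>0, \<alpha>\<^sub>3, \<alpha>\<^sub>4, \<alpha>\<^sub>5])"

definition s\<^sub>1 where
  "s\<^sub>1 = d5_transformation (\<lambda>x y z w t \<alpha>\<^sub>0 \<alpha>\<^sub>1 \<alpha>\<^sub>2 \<alpha>\<^sub>3 \<alpha>\<^sub>4 \<alpha>\<^sub>5.
     [x + \<alpha>\<^sub>1 / y, y, z, w, t, \<alpha>\<^sub>0, - \<alpha>\<^sub>1, \<alpha>\<^sub>2 + \<alpha>\<^sub>1, \<alpha>\<^sub>3, \<alpha>\<^sub>4, \<alpha>\<^sub>5])"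

definition s\<^sub>2 where
  "s\<^sub>2 = d5_transformation (\<lambda>x y z w t \<alpha>\<^sub>0 \<alpha>\<^sub>1 \<alpha>\<^sub>2 \<alpha>\<^sub>3 \<alpha>\<^sub>4 \<alpha>\<^sub>5.
     [x, y - \<alpha>\<^sub>2 / (x - z), z, w + \<alpha>\<^sub>2 / (x - z), t,
      \<alpha>\<^sub>0 + \<alpha>\<^sub>2, \<alpha>\<^sub>1 + \<alpha>\<^sub>2, - \<alpha>\<^sub>2, \<alpha>\<^sub>3 + \<alpha>\<^sub>2, \<alpha>\<^sub>4, \<alpha>\<^sub>5])"

definition s\<^sub>3 where
  "s\<^sub>3 = d5_transformation (\<lambda>x y z w t \<alpha>\<^sub>0 \<alpha>\<^sub>1 \<alpha>\<^sub>2 \<alpha>\<^sub>3 \<alpha>\<^sub>4 \<alpha>\<^sub>5.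
     [x, y, z + \<alpha>\<^sub>3 / w, w, t, \<alpha>\<^sub>0, \<alpha>\<^sub>1, \<alpha>\<^sub>2 + \<alpha>\<^sub>3, - \<alpha>\<^sub>3, \<alpha>\<^sub>4 + \<alpha>\<^sub>3, \<alpha>\<^sub>5 + \<alpha>\<^sub>3])"

definition s\<^sub>4 where
  "s\<^sub>4 = d5_transformation (\<lambda>x y z w t \<alpha>\<^sub>0 \<alpha>\<^sub>1 \<alpha>\<^sub>2 \<alpha>\<^sub>3 \<alpha>\<^sub>4 \<alpha>\<^sub>5.
     [x, y, z, w - \<alpha>\<^sub>4 / (z - 1), t, \<alpha>\<^sub>0, \<alpha>\<^sub>1, \<alpha>\<^sub>2, \<alpha>\<^sub>3 + \<alpha>\<^sub>4, - \<alpha>\<^sub>4, \<alpha>\<^sub>5])"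

definition s\<^sub>5 where
  "s\<^sub>5 = d5_transformation (\<lambda>x y z w t \<alpha>\<^sub>0 \<alpha>\<^sub>1 \<alpha>\<^sub>2 \<alpha>\<^sub>3 \<alpha>\<^sub>4 \<alpha>\<^sub>5.
     [x, y, z, w - \<alpha>\<^sub>5 / z, t, \<alpha>\<^sub>0, \<alpha>\<^sub>1, \<alpha>\<^sub>2, \<alpha>\<^sub>3 + \<alpha>\<^sub>5, \<alpha>\<^sub>4, - \<alpha>\<^sub>5])"

text \<open>
  The product of \<^const>\<open>BijGroup\<close> is composition of maps on functions, so \<open>(s s')(f) = s (s' f)\<close>.
\<close>

definition W_D5 :: "(d5var ratfun \<Rightarrow> d5var ratfun) monoid" where
  "W_D5 = (BijGroup UNIV)
     \<lparr>carrier := generate (BijGroup UNIV) {s\<^sub>0, s\<^sub>1, s\<^sub>2, s\<^sub>3, s\<^sub>4, s\<^sub>5}\<rparr>"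


section \<open>The group of type B4\<close>

text \<open>Again \<open>A\<^sub>0\<close> is eliminated by means of the relation \<open>A\<^sub>0 + A\<^sub>1 + 2 A\<^sub>2 + 2 A\<^sub>3 + 2 A\<^sub>4 = 1\<close>.\<close>

datatype b4var = VX | VY | VZ | VW | VT | VA1 | VA2 | VA3 | VA4

primrec b4idx :: "b4var \<Rightarrow> nat" where
  "b4idx VX = 0" | "b4idx VY = 1" | "b4idx VZ = 2" | "b4idx VW = 3" | "b4idx VT = 4"
| "b4idx VA1 = 5" | "b4idx VA2 = 6" | "b4idx VA3 = 7" | "b4idx VA4 = 8"

lemma b4idx_inject: "b4idx u = b4idx v \<longleftrightarrow> u = v"
  by (cases u; cases v) simp_all

instantiation b4var :: linorder
begin
definition less_eq_b4var :: "b4var \<Rightarrow> b4var \<Rightarrow> bool" where "less_eq_b4var u v \<longleftrightarrow> b4idx u \<le> b4idx v"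
definition less_b4var :: "b4var \<Rightarrow> b4var \<Rightarrow> bool" where "less_b4var u v \<longleftrightarrow> b4idx u < b4idx v"
instance
  by standard (auto simp: less_eq_b4var_def less_b4var_def b4idx_inject)
end

text \<open>
  \<open>b4_coords \<iota> f\<close> is \<open>f X Y Z W T A\<^sub>0 A\<^sub>1 A\<^sub>2 A\<^sub>3 A\<^sub>4\<close>, the variables being read in a function field
  through \<open>\<iota>\<close>. Two function fields occur: \<open>b4var ratfun\<close> itself, and \<open>b4var option ratfun\<close>, where
  \<^const>\<open>None\<close> is the additional variable \<open>\<epsilon>\<close>.
\<close>

definition b4_coords where
  "b4_coords \<iota> f =
     (let A\<^sub>1 = \<iota> VA1; A\<^sub>2 = \<iota> VA2; A\<^sub>3 = \<iota> VA3; A\<^sub>4 = \<iota> VA4;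
          A\<^sub>0 = 1 - A\<^sub>1 - 2 * A\<^sub>2 - 2 * A\<^sub>3 - 2 * A\<^sub>4
      in f (\<iota> VX) (\<iota> VY) (\<iota> VZ) (\<iota> VW) (\<iota> VT) A\<^sub>0 A\<^sub>1 A\<^sub>2 A\<^sub>3 A\<^sub>4)"

definition b4_gens :: "b4var ratfun list" where
  "b4_gens = b4_coords var (\<lambda>X Y Z W T A\<^sub>0 A\<^sub>1 A\<^sub>2 A\<^sub>3 A\<^sub>4. [X, Y, Z, W, T, A\<^sub>0, A\<^sub>1, A\<^sub>2, A\<^sub>3, A\<^sub>4])"

definition b4_transformation where
  "b4_transformation F = (iso_sending b4_gens (b4_coords var F) :: b4var ratfun \<Rightarrow> b4var ratfun)"

definition \<sigma>\<^sub>0 where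
  "\<sigma>\<^sub>0 = b4_transformation (\<lambda>X Y Z W T A\<^sub>0 A\<^sub>1 A\<^sub>2 A\<^sub>3 A\<^sub>4.
     [X + A\<^sub>0 / (Y - 1), Y, Z, W, T, - A\<^sub>0, A\<^sub>1, A\<^sub>2 + A\<^sub>0, A\<^sub>3, A\<^sub>4])"

definition \<sigma>\<^sub>1 where
  "\<sigma>\<^sub>1 = b4_transformation (\<lambda>X Y Z W T A\<^sub>0 A\<^sub>1 A\<^sub>2 A\<^sub>3 A\<^sub>4.
     [X + A\<^sub>1 / Y, Y, Z, W, T, A\<^sub>0, - A\<^sub>1, A\<^sub>2 + A\<^sub>1, A\<^sub>3, A\<^sub>4])"

definition \<sigma>\<^sub>2 where
  "\<sigma>\<^sub>2 = b4_transformation (\<lambda>X Y Z W T A\<^sub>0 A\<^sub>1 A\<^sub>2 A\<^sub>3 A\<^sub>4.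
     [X, Y - A\<^sub>2 / (X - Z), Z, W + A\<^sub>2 / (X - Z), T,
      A\<^sub>0 + A\<^sub>2, A\<^sub>1 + A\<^sub>2, - A\<^sub>2, A\<^sub>3 + A\<^sub>2, A\<^sub>4])"

definition \<sigma>\<^sub>3 where
  "\<sigma>\<^sub>3 = b4_transformation (\<lambda>X Y Z W T A\<^sub>0 A\<^sub>1 A\<^sub>2 A\<^sub>3 A\<^sub>4.
     [X, Y, Z + A\<^sub>3 / W, W, T, A\<^sub>0, A\<^sub>1, A\<^sub>2 + A\<^sub>3, - A\<^sub>3, A\<^sub>4 + A\<^sub>3])"

definition \<sigma>\<^sub>4 where
  "\<sigma>\<^sub>4 = b4_transformation (\<lambda>X Y Z W T A\<^sub>0 A\<^sub>1 A\<^sub>2 A\<^sub>3 A\<^sub>4.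
     [X, Y, Z, W - 2 * A\<^sub>4 / Z + T / Z ^ 2, - T, A\<^sub>0, A\<^sub>1, A\<^sub>2, A\<^sub>3 + 2 * A\<^sub>4, - A\<^sub>4])"

definition W_B4 :: "(b4var ratfun \<Rightarrow> b4var ratfun) monoid" where
  "W_B4 = (BijGroup UNIV)
     \<lparr>carrier := generate (BijGroup UNIV) {\<sigma>\<^sub>0, \<sigma>\<^sub>1, \<sigma>\<^sub>2, \<sigma>\<^sub>3, \<sigma>\<^sub>4}\<rparr>"


section \<open>The degeneration\<close>

definition eps_gens :: "b4var option ratfun list" where
  "eps_gens = b4_coords (\<lambda>u. var (Some u))
     (\<lambda>X Y Z W T A\<^sub>0 A\<^sub>1 A\<^sub>2 A\<^sub>3 A\<^sub>4. [X, Y, Z, W, T, A\<^sub>0, A\<^sub>1, A\<^sub>2, A\<^sub>3, A\<^sub>4])"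

text \<open>
  The change of parameters and variables, as an identification of the two function fields: the
  old quantities \<open>x, y, z, w, t, \<alpha>\<^sub>0, \<dots>, \<alpha>\<^sub>5\<close> are sent to their expressions in the new ones.
\<close>

definition degeneration :: "d5var ratfun \<Rightarrow> b4var option ratfun" where
  "degeneration = iso_sending d5_gens
     (let \<epsilon> = var None in
      b4_coords (\<lambda>u. var (Some u)) (\<lambda>X Y Z W T A\<^sub>0 A\<^sub>1 A\<^sub>2 A\<^sub>3 A\<^sub>4.
        [1 + X / (\<epsilon> * T), \<epsilon> * T * Y, 1 + Z / (\<epsilon> * T), \<epsilon> * T * W, - \<epsilon> * T,
         A\<^sub>0, A\<^sub>1, A\<^sub>2, A\<^sub>3, 2 * A\<^sub>4 - 1 / \<epsilon>, 1 / \<epsilon>]))"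

definition induced_action ::
    "(d5var ratfun \<Rightarrow> d5var ratfun) \<Rightarrow> b4var option ratfun \<Rightarrow> b4var option ratfun" where
  "induced_action S = degeneration \<circ> S \<circ> inv_into UNIV degeneration"

text \<open>
  \<open>f \<rightarrow> g\<close> as \<open>\<epsilon> \<rightarrow> 0\<close>: pointwise convergence at generic \<open>q\<close>, i.e. off the zero set of some
  nonzero polynomial \<open>h\<close>. This determines \<open>g\<close> uniquely. The regularity conditions say that all
  the values involved are genuine ones.
\<close>

definition tends_as_eps_to_0 :: "'v::linorder option ratfun \<Rightarrow> 'v ratfun \<Rightarrow> bool" where
  "tends_as_eps_to_0 f g \<longleftrightarrow>
     (\<exists>h. h \<noteq> 0 \<and> (\<forall>q. poly_at q h \<noteq> 0 \<longrightarrow>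
        regular_at q g \<and>
        (\<forall>\<^sub>F \<epsilon> in at 0. regular_at (case_option \<epsilon> q) f) \<and>
        ((\<lambda>\<epsilon>. value_at (case_option \<epsilon> q) f) \<longlongrightarrow> value_at q g) (at 0)))"

definition action_tends_to ::
    "(d5var ratfun \<Rightarrow> d5var ratfun) \<Rightarrow> (b4var ratfun \<Rightarrow> b4var ratfun) \<Rightarrow> bool" where
  "action_tends_to S \<sigma> \<longleftrightarrow>
     list_all2 tends_as_eps_to_0 (map (induced_action S) eps_gens) (map \<sigma> b4_gens)"

text \<open>
  Convergence of groups is convergence of systems of generators: \<open>H\<close> has generators
  \<open>S\<^sub>0, \<dots>, S\<^sub>4\<close> whose actions tend to those of the defining generators \<open>\<sigma>\<^sub>0, \<dots>, \<sigma>\<^sub>4\<close> of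
  \<^const>\<open>W_B4\<close>.
\<close>

definition converges_to_W_B4 :: "(d5var ratfun \<Rightarrow> d5var ratfun) set \<Rightarrow> bool" where
  "converges_to_W_B4 H \<longleftrightarrow>
     (\<exists>S\<^sub>0 S\<^sub>1 S\<^sub>2 S\<^sub>3 S\<^sub>4.
        H = generate W_D5 {S\<^sub>0, S\<^sub>1, S\<^sub>2, S\<^sub>3, S\<^sub>4} \<and>
        action_tends_to S\<^sub>0 \<sigma>\<^sub>0 \<and> action_tends_to S\<^sub>1 \<sigma>\<^sub>1 \<and> action_tends_to S\<^sub>2 \<sigma>\<^sub>2 \<and>
        action_tends_to S\<^sub>3 \<sigma>\<^sub>3 \<and> action_tends_to S\<^sub>4 \<sigma>\<^sub>4)"

end

theory Submission
  imports Defs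
begin

text \<open>
  The subgroup generated by \<open>s\<^sub>0, s\<^sub>1, s\<^sub>2, s\<^sub>3\<close> and \<open>s\<^sub>4 s\<^sub>5\<close> converges. In the new variables
  \<open>s\<^sub>0, s\<^sub>1, s\<^sub>2\<close> are literally \<open>\<sigma>\<^sub>0, \<sigma>\<^sub>1, \<sigma>\<^sub>2\<close>, and \<open>s\<^sub>3\<close> differs from \<open>\<sigma>\<^sub>3\<close> only in replacing
  \<open>T\<close> by \<open>T (1 + \<epsilon> A\<^sub>3)\<close>. The remaining generator \<open>\<sigma>\<^sub>4\<close> arises by confluence: in the product
  \<open>s\<^sub>4 s\<^sub>5\<close> two simple poles, with residues of order \<open>1 / \<epsilon>\<close> and a bounded sum, merge into a double pole
  (\<open>confluence_identity\<close>).

  The formulas of the generators and of the change of variables have to be shown to define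
  isomorphisms of function fields, and the limits have to be computed. Both rest on the partial ring
  homomorphism \<open>specializes\<close>, the substitution of elements of a field for the variables of a rational
  function whose denominator survives the substitution. First, an assignment of rational functions to
  the variables extends to an isomorphism if there is an assignment in the other direction such that
  each is undone by substituting the other (\<open>iso_extension\<close>). Secondly, if
  substitution of \<open>0\<close> for \<open>\<epsilon>\<close> is possible, then it gives the limit (\<open>specializes_imp_tends\<close>).
\<close>

section \<open>Evaluation of polynomials in a field\<close>

lemma cpoly_monomial_induct [case_names monomial add]:
  fixes p :: "'v::linorder cpoly"
  assumes monomial: "\<And>m c. P (Poly_Mapping.single m c)"
    and add: "\<And>p q. P p \<Longrightarrow> P q \<Longrightarrow> P (p + q)"
  shows "P p"
proof (induction p rule: update_induct)
  case const
  show ?case using monomial[of 0 0] by simp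
next
  case (update f a b)
  have "Poly_Mapping.update a b f = f + Poly_Mapping.single a b"
    using update(1)
    by (intro poly_mapping_eqI) (auto simp: lookup_update lookup_add lookup_single when_def in_keys_iff)
  then show ?case using add[OF update(3) monomial] by simp
qed

lemma single_var_power:
  "Poly_Mapping.single (Poly_Mapping.single v n) (1::complex)
     = Poly_Mapping.single (Poly_Mapping.single (v::'v::linorder) 1) 1 ^ n"
proof (induction n)
  case (Suc n)
  have "Poly_Mapping.single v (Suc n) = Poly_Mapping.single v 1 + Poly_Mapping.single v n"
    by (simp flip: single_add)
  then have "Poly_Mapping.single (Poly_Mapping.single v (Suc n)) (1::complex)
      = Poly_Mapping.single (Poly_Mapping.single v 1) 1 * Poly_Mapping.single (Poly_Mapping.single v n) 1"
    by (simp add: mult_single)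
  then show ?case by (simp only: Suc power_Suc)
qed simp

text \<open>
  Constants and variables generate the polynomial ring, so a property of rational functions or of
  evaluations that respects \<open>+\<close> and \<open>*\<close> has to be checked on those only.
\<close>

lemma cpoly_induct [case_names const var add mult]:
  fixes p :: "'v::linorder cpoly"
  assumes const: "\<And>c. P (Poly_Mapping.single 0 c)"
    and var: "\<And>v. P (Poly_Mapping.single (Poly_Mapping.single v 1) 1)"
    and add: "\<And>p q. P p \<Longrightarrow> P q \<Longrightarrow> P (p + q)"
    and mult: "\<And>p q. P p \<Longrightarrow> P q \<Longrightarrow> P (p * q)"
  shows "P p"
proof (induction p rule: cpoly_monomial_induct)
  case (monomial m c)
  show ?case
  proof (induction m rule: update_induct)
    case const
    show ?case by (rule assms(1))
  next
    case (update f a b)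
    have "P (Poly_Mapping.single (Poly_Mapping.single a 1) 1 ^ n)" for n
    proof (induction n)
      case 0
      show ?case using const[of 1] by simp
    qed (simp add: mult var[simplified])
    then have "P (Poly_Mapping.single f c * Poly_Mapping.single (Poly_Mapping.single a b) 1)"
      unfolding single_var_power[of a b] by (intro mult update)
    moreover have "Poly_Mapping.update a b f = f + Poly_Mapping.single a b"
      using update(1)
      by (intro poly_mapping_eqI) (auto simp: lookup_update lookup_add lookup_single when_def in_keys_iff)
    ultimately show ?case by (simp add: mult_single)
  qed
qed (rule add)

definition monom_eval :: "('v \<Rightarrow> 'k::field) \<Rightarrow> ('v \<Rightarrow>\<^sub>0 nat) \<Rightarrow> 'k" where
  "monom_eval e m = (\<Prod>v\<in>Poly_Mapping.keys m. e v ^ Poly_Mapping.lookup m v)"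

text \<open>
  Coefficients are carried into the field \<open>'k\<close> by \<open>\<kappa>\<close>. Two cases matter: \<open>'k\<close> the complex numbers
  and \<open>\<kappa>\<close> the identity (values at points), and \<open>'k\<close> a function field and \<open>\<kappa> = const\<close>
  (substitution of rational functions for the variables).
\<close>

definition cpoly_eval :: "(complex \<Rightarrow> 'k::field) \<Rightarrow> ('v \<Rightarrow> 'k) \<Rightarrow> 'v cpoly \<Rightarrow> 'k" where
  "cpoly_eval \<kappa> e p =
     (\<Sum>m\<in>Poly_Mapping.keys p. \<kappa> (Poly_Mapping.lookup p m) * monom_eval e m)"

lemma monom_eval_add: "monom_eval e (m + n) = monom_eval e m * monom_eval e n"
proof -
  have *: "monom_eval e k = (\<Prod>v\<in>Poly_Mapping.keys m \<union> Poly_Mapping.keys n. e v ^ Poly_Mapping.lookup k v)"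
    if "Poly_Mapping.keys k \<subseteq> Poly_Mapping.keys m \<union> Poly_Mapping.keys n" for k
    unfolding monom_eval_def using that
    by (intro prod.mono_neutral_left) (auto simp: in_keys_iff)
  show ?thesis
    by (simp add: * keys_add lookup_add power_add prod.distrib)
qed

lemma poly_at_eq_cpoly_eval: "poly_at = cpoly_eval (\<lambda>c. c)"
  by (simp add: fun_eq_iff poly_at_def cpoly_eval_def monom_eval_def)

locale scalar_hom =
  fixes \<kappa> :: "complex \<Rightarrow> 'k::field"
  assumes scalar_add: "\<kappa> (a + b) = \<kappa> a + \<kappa> b"
    and scalar_mult: "\<kappa> (a * b) = \<kappa> a * \<kappa> b"
    and scalar_one: "\<kappa> 1 = 1"
begin

lemma scalar_zero: "\<kappa> 0 = 0"
  using scalar_add[of 0 0] by (metis add_0 add_cancel_right_right)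

lemma eval_add: "cpoly_eval \<kappa> e (p + q) = cpoly_eval \<kappa> e p + cpoly_eval \<kappa> e q"
  unfolding cpoly_eval_def
  by (rule setsum_keys_plus_distrib) (simp_all add: scalar_add scalar_zero algebra_simps)

lemma eval_single: "cpoly_eval \<kappa> e (Poly_Mapping.single m c) = \<kappa> c * monom_eval e m"
  by (simp add: cpoly_eval_def scalar_zero)

lemma eval_mult:
  fixes p q :: "'v::linorder cpoly"
  shows "cpoly_eval \<kappa> e (p * q) = cpoly_eval \<kappa> e p * cpoly_eval \<kappa> e q"
proof (induction p rule: cpoly_monomial_induct)
  case (monomial m c)
  show ?case
    by (induction q rule: cpoly_monomial_induct)
      (simp_all add: mult_single eval_single monom_eval_add scalar_mult algebra_simps eval_add)
qed (simp add: algebra_simps eval_add)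

lemma eval_const: "cpoly_eval \<kappa> e (Poly_Mapping.single 0 c) = \<kappa> c"
  by (simp add: eval_single monom_eval_def)

lemma eval_var: "cpoly_eval \<kappa> e (Poly_Mapping.single (Poly_Mapping.single v 1) 1) = e v"
  by (simp add: eval_single monom_eval_def scalar_one)

lemma eval_zero: "cpoly_eval \<kappa> e 0 = 0"
  by (simp add: cpoly_eval_def scalar_zero)

lemma eval_one: "cpoly_eval \<kappa> e 1 = 1"
  using eval_const[of e 1] by (simp add: scalar_one)

lemma eval_uminus: "cpoly_eval \<kappa> e (- p) = - cpoly_eval \<kappa> e p"
  using eval_add[of e p "- p"] by (simp add: eval_zero add_eq_0_iff)

end

section \<open>Specialization of rational functions\<close>

text \<open>
  Substituting \<open>e v\<close> for each variable \<open>v\<close> makes sense on the local ring of those rational functions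
  that have a denominator which does not become zero. A relation expresses this partial map without
  an arbitrary value outside of its domain, and its closure rules compute values and check
  denominators in one pass.
\<close>

definition specializes ::
    "(complex \<Rightarrow> 'k::field) \<Rightarrow> ('v \<Rightarrow> 'k) \<Rightarrow> 'v::linorder ratfun \<Rightarrow> 'k \<Rightarrow> bool" where
  "specializes \<kappa> e f g \<longleftrightarrow>
     (\<exists>a b. f = Fract a b \<and> cpoly_eval \<kappa> e b \<noteq> 0 \<and> g = cpoly_eval \<kappa> e a / cpoly_eval \<kappa> e b)"

context scalar_hom
begin

lemma specializesI:
  "f = Fract a b \<Longrightarrow> cpoly_eval \<kappa> e b \<noteq> 0 \<Longrightarrow> g = cpoly_eval \<kappa> e a / cpoly_eval \<kappa> e b
    \<Longrightarrow> specializes \<kappa> e f g"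
  by (auto simp: specializes_def)

lemma specializesE:
  assumes "specializes \<kappa> e f g"
  obtains a b where "f = Fract a b" "b \<noteq> 0" "cpoly_eval \<kappa> e b \<noteq> 0"
    "g = cpoly_eval \<kappa> e a / cpoly_eval \<kappa> e b"
  using assms eval_zero unfolding specializes_def by metis

lemma specializes_unique:
  assumes "specializes \<kappa> e f g" "specializes \<kappa> e f g'"
  shows "g = g'"
proof -
  obtain a b where ab: "f = Fract a b" "b \<noteq> 0" "cpoly_eval \<kappa> e b \<noteq> 0"
    "g = cpoly_eval \<kappa> e a / cpoly_eval \<kappa> e b" using assms(1) by (rule specializesE)
  obtain a' b' where ab': "f = Fract a' b'" "b' \<noteq> 0" "cpoly_eval \<kappa> e b' \<noteq> 0"
    "g' = cpoly_eval \<kappa> e a' / cpoly_eval \<kappa> e b'" using assms(2) by (rule specializesE)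
  have "a * b' = a' * b" using ab ab' by (simp add: eq_fract)
  then have "cpoly_eval \<kappa> e a * cpoly_eval \<kappa> e b' = cpoly_eval \<kappa> e a' * cpoly_eval \<kappa> e b"
    by (metis eval_mult)
  then show ?thesis using ab ab' by (simp add: frac_eq_eq)
qed

lemma specializes_var: "specializes \<kappa> e (var v) (e v)"
  unfolding var_def by (rule specializesI[OF refl]) (simp_all only: eval_var eval_one, simp_all)

lemma specializes_const: "specializes \<kappa> e (const c) (\<kappa> c)"
  unfolding const_def by (rule specializesI[OF refl]) (simp_all add: eval_const eval_one)

lemma specializes_zero: "specializes \<kappa> e 0 0"
  unfolding Zero_fract_def by (rule specializesI[OF refl]) (simp_all add: eval_zero eval_one)

lemma specializes_one: "specializes \<kappa> e 1 1"
  unfolding One_fract_def by (rule specializesI[OF refl]) (simp_all add: eval_one)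

lemma specializes_add:
  assumes "specializes \<kappa> e f g" "specializes \<kappa> e f' g'"
  shows "specializes \<kappa> e (f + f') (g + g')"
proof -
  obtain a b where "f = Fract a b" "b \<noteq> 0" "cpoly_eval \<kappa> e b \<noteq> 0"
    "g = cpoly_eval \<kappa> e a / cpoly_eval \<kappa> e b" using assms(1) by (rule specializesE)
  moreover obtain a' b' where "f' = Fract a' b'" "b' \<noteq> 0" "cpoly_eval \<kappa> e b' \<noteq> 0"
    "g' = cpoly_eval \<kappa> e a' / cpoly_eval \<kappa> e b'" using assms(2) by (rule specializesE)
  ultimately show ?thesis
    by (intro specializesI[of _ "a * b' + a' * b" "b * b'"])
      (simp_all add: eval_add eval_mult add_frac_eq)
qed

lemma specializes_mult:
  assumes "specializes \<kappa> e f g" "specializes \<kappa> e f' g'"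
  shows "specializes \<kappa> e (f * f') (g * g')"
proof -
  obtain a b where "f = Fract a b" "cpoly_eval \<kappa> e b \<noteq> 0"
    "g = cpoly_eval \<kappa> e a / cpoly_eval \<kappa> e b" using assms(1) by (rule specializesE)
  moreover obtain a' b' where "f' = Fract a' b'" "cpoly_eval \<kappa> e b' \<noteq> 0"
    "g' = cpoly_eval \<kappa> e a' / cpoly_eval \<kappa> e b'" using assms(2) by (rule specializesE)
  ultimately show ?thesis
    by (intro specializesI[of _ "a * a'" "b * b'"]) (simp_all add: eval_mult)
qed

lemma specializes_uminus:
  assumes "specializes \<kappa> e f g"
  shows "specializes \<kappa> e (- f) (- g)"
proof -
  obtain a b where "f = Fract a b" "cpoly_eval \<kappa> e b \<noteq> 0"
    "g = cpoly_eval \<kappa> e a / cpoly_eval \<kappa> e b" using assms by (rule specializesE)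
  then show ?thesis
    by (intro specializesI[of _ "- a" b]) (simp_all add: eval_uminus)
qed

lemma specializes_inverse:
  assumes "specializes \<kappa> e f g" "g \<noteq> 0"
  shows "specializes \<kappa> e (inverse f) (inverse g)"
proof -
  obtain a b where "f = Fract a b" "cpoly_eval \<kappa> e b \<noteq> 0"
    "g = cpoly_eval \<kappa> e a / cpoly_eval \<kappa> e b" using assms(1) by (rule specializesE)
  then show ?thesis
    using assms(2) by (intro specializesI[of _ b a]) simp_all
qed

lemma specializes_diff:
  assumes "specializes \<kappa> e f g" "specializes \<kappa> e f' g'"
  shows "specializes \<kappa> e (f - f') (g - g')"
  using specializes_add[OF assms(1) specializes_uminus[OF assms(2)]] by simp

lemma specializes_divide:
  assumes "specializes \<kappa> e f g" "specializes \<kappa> e f' g'" "g' \<noteq> 0"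
  shows "specializes \<kappa> e (f / f') (g / g')"
  using specializes_mult[OF assms(1) specializes_inverse[OF assms(2,3)]]
  by (simp add: divide_inverse)

lemma specializes_power:
  assumes "specializes \<kappa> e f g"
  shows "specializes \<kappa> e (f ^ n) (g ^ n)"
  by (induction n) (simp_all add: specializes_one specializes_mult assms)

lemma specializes_numeral: "specializes \<kappa> e (numeral n) (numeral n)"
  by (induction n) (simp_all only: numeral.simps specializes_one specializes_add)

text \<open>
  Resolution with these rules computes the value of the second argument as a schematic variable:
  the condition \<open>g' \<noteq> 0\<close> of \<open>specializes_divide\<close> comes last, when \<open>g'\<close> is already known.
\<close>

lemmas specializes_intros =
  specializes_var specializes_const specializes_zero specializes_one specializes_numeral
  specializes_add specializes_diff specializes_uminus specializes_mult specializes_divide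
  specializes_power

text \<open>Starting with this rule leaves the comparison with the expected value as the last goal.\<close>

lemma specializes_eq:
  "specializes \<kappa> e f g \<Longrightarrow> g = g' \<Longrightarrow> specializes \<kappa> e f g'"
  by simp

end

interpretation complex_scalar: scalar_hom "\<lambda>c::complex. c"
  by standard simp_all

interpretation const_scalar: scalar_hom "const :: complex \<Rightarrow> 'v::linorder ratfun"
proof
  show "const (a + b) = (const a + const b :: 'v ratfun)" for a b
    by (simp add: const_def single_add)
  show "const (a * b) = (const a * const b :: 'v ratfun)" for a b
    by (simp add: const_def mult_single)
  show "const 1 = (1 :: 'v ratfun)"
    unfolding const_def One_fract_def by simp
qed


section \<open>Homomorphisms of function fields\<close>

locale function_field_hom =
  fixes \<Phi> :: "'v::linorder ratfun \<Rightarrow> 'w::linorder ratfun"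
  assumes hom_add: "\<Phi> (f + g) = \<Phi> f + \<Phi> g"
    and hom_mult: "\<Phi> (f * g) = \<Phi> f * \<Phi> g"
    and hom_const: "\<Phi> (const c) = const c"
begin

lemma hom_zero: "\<Phi> 0 = 0"
  using hom_const[of 0] by (simp only: const_scalar.scalar_zero)

lemma hom_one: "\<Phi> 1 = 1"
  using hom_const[of 1] by (simp only: const_scalar.scalar_one)

lemma hom_uminus: "\<Phi> (- f) = - \<Phi> f"
  using hom_add[of f "- f"] by (simp add: hom_zero add_eq_0_iff)

lemma hom_diff: "\<Phi> (f - g) = \<Phi> f - \<Phi> g"
  using hom_add[of f "- g"] by (simp add: hom_uminus)

lemma hom_inverse: "\<Phi> (inverse f) = inverse (\<Phi> f)"
proof (cases "f = 0")
  case False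
  then have "\<Phi> f * \<Phi> (inverse f) = 1"
    using hom_mult[of f "inverse f"] by (simp add: hom_one)
  then show ?thesis by (metis inverse_unique)
qed (simp add: hom_zero)

lemma hom_divide: "\<Phi> (f / g) = \<Phi> f / \<Phi> g"
  by (simp add: divide_inverse hom_mult hom_inverse)

lemma hom_power: "\<Phi> (f ^ n) = \<Phi> f ^ n"
  by (induction n) (simp_all add: hom_one hom_mult)

lemma hom_numeral: "\<Phi> (numeral n) = numeral n"
  by (induction n) (simp_all only: numeral.simps hom_one hom_add)

lemma hom_nonzero: "f \<noteq> 0 \<Longrightarrow> \<Phi> f \<noteq> 0"
  using hom_mult[of f "inverse f"] by (auto simp: hom_one)

lemmas hom_simps = hom_add hom_mult hom_const hom_zero hom_one hom_uminus hom_diff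
  hom_divide hom_power hom_numeral

text \<open>
  Since every rational function is a quotient of polynomials, a homomorphism is substitution of the
  images of the variables. It is therefore determined by them.
\<close>

lemma specializes_hom: "specializes const (\<lambda>v. \<Phi> (var v)) f (\<Phi> f)"
proof -
  obtain a b where ab: "f = Fract a b" "b \<noteq> 0"
    by (rule Fract_cases)
  have poly: "\<Phi> (Fract p 1) = cpoly_eval const (\<lambda>v. \<Phi> (var v)) p" for p
  proof (induction p rule: cpoly_induct)
    case (const c)
    show ?case using hom_const[of c] by (simp add: const_def[of c] const_scalar.eval_const)
  next
    case (var v)
    show ?case unfolding const_scalar.eval_var by (simp add: var_def)
  next
    case (add p q)
    then show ?case using hom_add[of "Fract p 1" "Fract q 1"] by (simp add: const_scalar.eval_add)
  next
    case (mult p q)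
    then show ?case using hom_mult[of "Fract p 1" "Fract q 1"] by (simp add: const_scalar.eval_mult)
  qed
  have f: "f = Fract a 1 / Fract b 1" and "Fract b 1 \<noteq> 0"
    using ab by (simp_all add: Zero_fract_def eq_fract)
  then have "cpoly_eval const (\<lambda>v. \<Phi> (var v)) b \<noteq> 0"
    using hom_nonzero poly by metis
  moreover have "\<Phi> f = \<Phi> (Fract a 1) / \<Phi> (Fract b 1)"
    unfolding f by (rule hom_divide)
  ultimately show ?thesis
    using ab by (intro const_scalar.specializesI) (simp_all add: poly)
qed

end

lemma hom_eqI:
  fixes \<Phi> \<Psi> :: "'v::linorder ratfun \<Rightarrow> 'w::linorder ratfun"
  assumes "function_field_hom \<Phi>" "function_field_hom \<Psi>" "\<And>v. \<Phi> (var v) = \<Psi> (var v)"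
  shows "\<Phi> = \<Psi>"
proof
  fix f
  show "\<Phi> f = \<Psi> f"
    using function_field_hom.specializes_hom[OF assms(1), of f]
      function_field_hom.specializes_hom[OF assms(2), of f]
    by (auto simp: assms(3) intro: const_scalar.specializes_unique)
qed

lemma function_field_iso_iff: "function_field_iso \<Phi> \<longleftrightarrow> bij \<Phi> \<and> function_field_hom \<Phi>"
  by (auto simp: function_field_iso_def function_field_hom_def)

text \<open>
  Substitution of \<open>\<phi>\<close> is defined on the whole function field if no nonzero polynomial becomes zero.
  The hypothesis, that \<open>\<psi>\<close> undoes \<open>\<phi>\<close> on variables, ensures this: then \<open>\<psi>\<close> undoes \<open>\<phi>\<close> on every
  polynomial \<open>p\<close>, so if \<open>p\<close> becomes zero, it is the value of zero and hence zero itself.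
\<close>

lemma hom_extension:
  fixes \<phi> :: "'v::linorder \<Rightarrow> 'w::linorder ratfun" and \<psi> :: "'w \<Rightarrow> 'v ratfun"
  assumes "\<And>v. specializes const \<psi> (\<phi> v) (var v)"
  obtains \<Phi> where "function_field_hom \<Phi>" "\<And>v. \<Phi> (var v) = \<phi> v"
proof -
  have poly: "specializes const \<psi> (cpoly_eval const \<phi> p) (Fract p 1)" for p
  proof (induction p rule: cpoly_induct)
    case (const c)
    show ?case unfolding const_scalar.eval_const
      using const_scalar.specializes_const[of \<psi> c] by (simp add: const_def[of c])
  next
    case (var v)
    show ?case unfolding const_scalar.eval_var using assms[of v] by (simp add: var_def)
  next
    case (add p q)
    then show ?case using const_scalar.specializes_add[OF add] by (simp add: const_scalar.eval_add)
  next
    case (mult p q)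
    then show ?case using const_scalar.specializes_mult[OF mult] by (simp add: const_scalar.eval_mult)
  qed
  have inj: "cpoly_eval const \<phi> p \<noteq> 0" if "p \<noteq> 0" for p
  proof
    assume "cpoly_eval const \<phi> p = 0"
    then have "specializes const \<psi> 0 (Fract p 1)" using poly[of p] by simp
    then have "Fract p 1 = 0"
      using const_scalar.specializes_zero const_scalar.specializes_unique by metis
    with that show False by (simp add: Zero_fract_def eq_fract)
  qed
  have total: "\<exists>g. specializes const \<phi> f g" for f
  proof -
    obtain a b where ab: "f = Fract a b" "b \<noteq> 0"
      by (rule Fract_cases)
    then show ?thesis using const_scalar.specializesI[OF ab(1) inj[OF ab(2)] refl] by blast
  qed
  define \<Phi> where "\<Phi> f = (THE g. specializes const \<phi> f g)" for f
  have \<Phi>: "\<Phi> f = g" if "specializes const \<phi> f g" for f g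
    unfolding \<Phi>_def using that by (rule the_equality) (rule const_scalar.specializes_unique[OF _ that])
  have spec: "specializes const \<phi> f (\<Phi> f)" for f
    using total[of f] \<Phi> by auto
  show ?thesis
  proof
    show "function_field_hom \<Phi>"
      by standard (intro \<Phi> const_scalar.specializes_intros spec)+
    show "\<Phi> (var v) = \<phi> v" for v
      by (intro \<Phi> const_scalar.specializes_intros)
  qed
qed

text \<open>
  The two extensions are inverse to each other because their composites fix the variables. This
  turns the construction of a birational map into finitely many computations with \<open>specializes\<close>.
\<close>

lemma iso_extension:
  fixes \<phi> :: "'v::linorder \<Rightarrow> 'w::linorder ratfun" and \<psi> :: "'w \<Rightarrow> 'v ratfun"
  assumes "\<And>v. specializes const \<psi> (\<phi> v) (var v)" and "\<And>w. specializes const \<phi> (\<psi> w) (var w)"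
  obtains \<Phi> where "function_field_iso \<Phi>" "\<And>v. \<Phi> (var v) = \<phi> v"
proof -
  obtain \<Phi> where \<Phi>: "function_field_hom \<Phi>" "\<And>v. \<Phi> (var v) = \<phi> v"
    by (rule hom_extension[of \<psi> \<phi>]) (use assms in auto)
  obtain \<Psi> where \<Psi>: "function_field_hom \<Psi>" "\<And>w. \<Psi> (var w) = \<psi> w"
    by (rule hom_extension[of \<phi> \<psi>]) (use assms in auto)
  interpret \<Phi>: function_field_hom \<Phi> by fact
  interpret \<Psi>: function_field_hom \<Psi> by fact
  have "\<Psi> \<circ> \<Phi> = id"
  proof (rule hom_eqI)
    show "function_field_hom (\<Psi> \<circ> \<Phi>)"
      by standard (simp_all add: \<Phi>.hom_simps \<Psi>.hom_simps)
    show "(\<Psi> \<circ> \<Phi>) (var v) = id (var v)" for v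
      using \<Psi>.specializes_hom[of "\<phi> v"] assms(1)[of v]
      by (auto simp: \<Phi>(2) \<Psi>(2) intro: const_scalar.specializes_unique)
  qed (standard, simp_all)
  moreover have "\<Phi> \<circ> \<Psi> = id"
  proof (rule hom_eqI)
    show "function_field_hom (\<Phi> \<circ> \<Psi>)"
      by standard (simp_all add: \<Phi>.hom_simps \<Psi>.hom_simps)
    show "(\<Phi> \<circ> \<Psi>) (var v) = id (var v)" for v
      using \<Phi>.specializes_hom[of "\<psi> v"] assms(2)[of v]
      by (auto simp: \<Phi>(2) \<Psi>(2) intro: const_scalar.specializes_unique)
  qed (standard, simp_all)
  ultimately have "bij \<Phi>"
    by (rule o_bij)
  then show ?thesis
    using that \<Phi> by (simp add: function_field_iso_iff)
qed

lemma iso_sending_eqI: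
  assumes "function_field_iso \<Phi>" "map \<Phi> fs = gs" "range var \<subseteq> set fs"
  shows "iso_sending fs gs = \<Phi>"
  unfolding iso_sending_def
proof (rule the_equality)
  fix \<Psi> :: "'a ratfun \<Rightarrow> 'b ratfun"
  assume \<Psi>: "function_field_iso \<Psi> \<and> map \<Psi> fs = gs"
  then have "\<Psi> f = \<Phi> f" if "f \<in> set fs" for f
    using assms(2) that by (metis map_eq_conv)
  then show "\<Psi> = \<Phi>"
    using assms(1,3) \<Psi> by (intro hom_eqI) (auto simp: function_field_iso_iff)
qed (use assms in simp)

definition iso_extending ::
    "('v::linorder ratfun \<Rightarrow> 'w::linorder ratfun) \<Rightarrow> ('v \<Rightarrow> 'w ratfun) \<Rightarrow> bool" where
  "iso_extending \<Phi> \<phi> \<longleftrightarrow> function_field_iso \<Phi> \<and> (\<forall>v. \<Phi> (var v) = \<phi> v)"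

lemma iso_extendingD:
  assumes "iso_extending \<Phi> \<phi>"
  shows "function_field_iso \<Phi>" "function_field_hom \<Phi>" "bij \<Phi>" "\<Phi> (var v) = \<phi> v"
  using assms by (simp_all add: iso_extending_def function_field_iso_iff)

text \<open>
  For a complete list of generators, \<^const>\<open>iso_sending\<close> is the extension of the assignment of its
  variables, provided that the prescribed images of the other members of the list are consistent.
\<close>

lemma iso_extending_iso_sending:
  assumes "\<And>v. specializes const \<psi> (\<phi> v) (var v)" and "\<And>w. specializes const \<phi> (\<psi> w) (var w)"
    and range: "range var \<subseteq> set fs"
    and gs: "\<And>\<Phi>. iso_extending \<Phi> \<phi> \<Longrightarrow> map \<Phi> fs = gs"
  shows "iso_extending (iso_sending fs gs) \<phi>"
proof -
  obtain \<Phi> where "function_field_iso \<Phi>" "\<And>v. \<Phi> (var v) = \<phi> v"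
    by (rule iso_extension[of \<psi> \<phi>]) (use assms in auto)
  then have \<Phi>: "iso_extending \<Phi> \<phi>" by (simp add: iso_extending_def)
  then have "iso_sending fs gs = \<Phi>"
    using range gs by (intro iso_sending_eqI) (simp_all add: iso_extendingD)
  with \<Phi> show ?thesis by simp
qed


section \<open>Limits as specializations\<close>

lemma specializes_value_at:
  assumes "specializes (\<lambda>c. c) q f c"
  shows "regular_at q f" "value_at q f = c"
proof -
  show "regular_at q f"
    using assms unfolding specializes_def regular_at_def poly_at_eq_cpoly_eval by blast
  have "value_at q f = (THE c. specializes (\<lambda>c. c) q f c)"
    unfolding value_at_def specializes_def poly_at_eq_cpoly_eval ..
  also have "\<dots> = c"
    using assms by (rule the_equality) (rule complex_scalar.specializes_unique[OF _ assms])
  finally show "value_at q f = c" .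
qed

lemma tendsto_poly_at_eps:
  fixes p :: "'v::linorder option cpoly"
  shows "((\<lambda>\<epsilon>. poly_at (case_option \<epsilon> q) p) \<longlongrightarrow> poly_at (case_option 0 q) p) (at 0)"
proof (induction p rule: cpoly_induct)
  case (const c)
  show ?case by (simp add: poly_at_eq_cpoly_eval complex_scalar.eval_const)
next
  case (var v)
  show ?case
    unfolding poly_at_eq_cpoly_eval complex_scalar.eval_var by (cases v) auto
qed (simp_all add: poly_at_eq_cpoly_eval complex_scalar.eval_add complex_scalar.eval_mult
    tendsto_add tendsto_mult)

text \<open>
  Putting \<open>\<epsilon> = 0\<close> in a polynomial gives a polynomial in the other variables. Its values are needed,
  as the exceptional set of a limit is the zero set of the denominator obtained in this way.
\<close>

lemma cpoly_eval_eps_zero: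
  fixes p :: "'v::linorder option cpoly"
  shows "\<exists>p\<^sub>0. cpoly_eval const (case_option 0 var) p = Fract p\<^sub>0 1 \<and>
      (\<forall>q. poly_at q p\<^sub>0 = poly_at (case_option 0 q) p)"
proof (induction p rule: cpoly_induct)
  case (const c)
  show ?case
    by (rule exI[of _ "Poly_Mapping.single 0 c"])
      (simp add: const_scalar.eval_const const_def[of c] poly_at_eq_cpoly_eval complex_scalar.eval_const)
next
  case (var v)
  show ?case
  proof (cases v)
    case None
    show ?thesis
      unfolding const_scalar.eval_var poly_at_eq_cpoly_eval complex_scalar.eval_var
      by (rule exI[of _ 0]) (simp add: None Zero_fract_def complex_scalar.eval_zero)
  next
    case (Some u)
    show ?thesis
      unfolding const_scalar.eval_var poly_at_eq_cpoly_eval complex_scalar.eval_var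
      by (rule exI[of _ "Poly_Mapping.single (Poly_Mapping.single u 1) 1"])
        (simp add: Some var_def complex_scalar.eval_var[simplified])
  qed
next
  case (add p q)
  then obtain p\<^sub>0 q\<^sub>0 where "cpoly_eval const (case_option 0 var) p = Fract p\<^sub>0 1"
    "\<forall>x. poly_at x p\<^sub>0 = poly_at (case_option 0 x) p"
    "cpoly_eval const (case_option 0 var) q = Fract q\<^sub>0 1"
    "\<forall>x. poly_at x q\<^sub>0 = poly_at (case_option 0 x) q" by blast
  then show ?case
    by (intro exI[of _ "p\<^sub>0 + q\<^sub>0"])
      (simp add: poly_at_eq_cpoly_eval complex_scalar.eval_add const_scalar.eval_add)
next
  case (mult p q)
  then obtain p\<^sub>0 q\<^sub>0 where "cpoly_eval const (case_option 0 var) p = Fract p\<^sub>0 1"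
    "\<forall>x. poly_at x p\<^sub>0 = poly_at (case_option 0 x) p"
    "cpoly_eval const (case_option 0 var) q = Fract q\<^sub>0 1"
    "\<forall>x. poly_at x q\<^sub>0 = poly_at (case_option 0 x) q" by blast
  then show ?case
    by (intro exI[of _ "p\<^sub>0 * q\<^sub>0"])
      (simp add: poly_at_eq_cpoly_eval complex_scalar.eval_mult const_scalar.eval_mult)
qed

text \<open>
  Rational functions are continuous where their denominators do not vanish. So if \<open>f\<close> has a
  denominator that is not divisible by \<open>\<epsilon>\<close>, then its limit for \<open>\<epsilon> \<rightarrow> 0\<close> is the result of
  putting \<open>\<epsilon> = 0\<close>, and all limits below reduce to algebra.
\<close>

lemma specializes_imp_tends:
  assumes "specializes const (case_option 0 var) f g"
  shows "tends_as_eps_to_0 f g"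
proof -
  obtain a b where f: "f = Fract a b" and b: "cpoly_eval const (case_option 0 var) b \<noteq> 0"
    and g: "g = cpoly_eval const (case_option 0 var) a / cpoly_eval const (case_option 0 var) b"
    using assms by (rule const_scalar.specializesE)
  obtain a\<^sub>0 where a\<^sub>0: "cpoly_eval const (case_option 0 var) a = Fract a\<^sub>0 1"
    "\<And>q. poly_at q a\<^sub>0 = poly_at (case_option 0 q) a"
    using cpoly_eval_eps_zero[of a] by blast
  obtain b\<^sub>0 where b\<^sub>0: "cpoly_eval const (case_option 0 var) b = Fract b\<^sub>0 1"
    "\<And>q. poly_at q b\<^sub>0 = poly_at (case_option 0 q) b"
    using cpoly_eval_eps_zero[of b] by blast
  have val: "specializes (\<lambda>c. c) q (Fract a' b') (poly_at q a' / poly_at q b')"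
    if "poly_at q b' \<noteq> 0" for q :: "'x::linorder \<Rightarrow> complex" and a' b'
    using that unfolding poly_at_eq_cpoly_eval by (intro complex_scalar.specializesI[OF refl]) simp_all
  have g': "g = Fract a\<^sub>0 b\<^sub>0"
    using g a\<^sub>0(1) b\<^sub>0(1) by simp
  show ?thesis
    unfolding tends_as_eps_to_0_def
  proof (intro exI conjI allI impI)
    show "b\<^sub>0 \<noteq> 0"
      using b b\<^sub>0(1) by (auto simp: Zero_fract_def)
    fix q assume q: "poly_at q b\<^sub>0 \<noteq> 0"
    note gq = specializes_value_at[OF val[OF q], of a\<^sub>0, folded g']
    show "regular_at q g" by (rule gq(1))
    have ev: "\<forall>\<^sub>F \<epsilon> in at 0. poly_at (case_option \<epsilon> q) b \<noteq> 0"
      using q unfolding b\<^sub>0(2) by (rule tendsto_imp_eventually_ne[OF tendsto_poly_at_eps])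
    then show "\<forall>\<^sub>F \<epsilon> in at 0. regular_at (case_option \<epsilon> q) f"
      by eventually_elim (simp add: f specializes_value_at[OF val])
    have "((\<lambda>\<epsilon>. poly_at (case_option \<epsilon> q) a / poly_at (case_option \<epsilon> q) b)
        \<longlongrightarrow> poly_at (case_option 0 q) a / poly_at (case_option 0 q) b) (at 0)"
      using q by (intro tendsto_divide tendsto_poly_at_eps) (simp add: b\<^sub>0(2))
    moreover have "\<forall>\<^sub>F \<epsilon> in at 0. value_at (case_option \<epsilon> q) f
        = poly_at (case_option \<epsilon> q) a / poly_at (case_option \<epsilon> q) b"
      using ev by eventually_elim (simp add: f specializes_value_at[OF val])
    ultimately show "((\<lambda>\<epsilon>. value_at (case_option \<epsilon> q) f) \<longlongrightarrow> value_at q g) (at 0)"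
      by (simp add: gq(2) a\<^sub>0(2) b\<^sub>0(2) tendsto_cong)
  qed
qed


section \<open>Nonvanishing of denominators\<close>

lemma specializes_nonzero:
  fixes f :: "'v::linorder ratfun"
  assumes "specializes (\<lambda>c. c) q f c" "c \<noteq> 0"
  shows "f \<noteq> 0"
  using assms complex_scalar.specializes_zero complex_scalar.specializes_unique by metis

lemma var_nonzero: "var v \<noteq> 0"
  by (rule specializes_nonzero[of "\<lambda>_. 1"], (rule complex_scalar.specializes_intros)+) simp

lemma var_add_var_nonzero: "var u + var v \<noteq> 0"
  by (rule specializes_nonzero[of "\<lambda>_. 1"], (rule complex_scalar.specializes_intros)+) simp

text \<open>
  Simplification turns \<open>f - g \<noteq> 0\<close> into \<open>f \<noteq> g\<close>, hence the form of the next two facts.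
\<close>

lemma var_eq_var_iff: "var u = var v \<longleftrightarrow> u = v"
proof -
  have "u \<noteq> v \<Longrightarrow> var u - var v \<noteq> 0"
    by (rule specializes_nonzero[of "\<lambda>w. if w = u then 1 else 0"],
        (rule complex_scalar.specializes_intros)+) simp
  then show ?thesis by auto
qed

lemma var_neq_one: "var v \<noteq> 1"
proof -
  have "var v - 1 \<noteq> 0"
    by (rule specializes_nonzero[of "\<lambda>_. 0"], (rule complex_scalar.specializes_intros)+) simp
  then show ?thesis by simp
qed

lemma two_nonzero: "(2 :: 'v::linorder ratfun) \<noteq> 0"
  by (rule specializes_nonzero[of "\<lambda>_. 0"], (rule complex_scalar.specializes_intros)+) simp

lemmas nonzero = var_nonzero var_add_var_nonzero var_eq_var_iff var_neq_one two_nonzero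


section \<open>The generators of the group of type D5\<close>

abbreviation \<alpha>0 :: "d5var ratfun" where
  "\<alpha>0 \<equiv> 1 - var V\<alpha>1 - 2 * var V\<alpha>2 - 2 * var V\<alpha>3 - var V\<alpha>4 - var V\<alpha>5"

lemma range_var_subset_d5_gens: "range var \<subseteq> set d5_gens"
proof
  fix f :: "d5var ratfun" assume "f \<in> range var"
  then obtain v where "f = var v" by blast
  then show "f \<in> set d5_gens"
    by (cases v) (simp_all add: d5_gens_def d5_coords_def Let_def)
qed

lemma d5_iso_sending:
  fixes \<phi> :: "d5var \<Rightarrow> 'w::linorder ratfun"
  assumes "\<And>v. specializes const \<psi> (\<phi> v) (var v)" "\<And>w. specializes const \<phi> (\<psi> w) (var w)"
    and gs: "gs = [\<phi> Vx, \<phi> Vy, \<phi> Vz, \<phi> Vw, \<phi> Vt,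
      1 - \<phi> V\<alpha>1 - 2 * \<phi> V\<alpha>2 - 2 * \<phi> V\<alpha>3 - \<phi> V\<alpha>4 - \<phi> V\<alpha>5,
      \<phi> V\<alpha>1, \<phi> V\<alpha>2, \<phi> V\<alpha>3, \<phi> V\<alpha>4, \<phi> V\<alpha>5]"
  shows "iso_extending (iso_sending d5_gens gs) \<phi>"
proof (rule iso_extending_iso_sending[OF assms(1,2) range_var_subset_d5_gens])
  fix \<Phi> assume \<Phi>: "iso_extending \<Phi> \<phi>"
  then interpret function_field_hom \<Phi> by (rule iso_extendingD)
  show "map \<Phi> d5_gens = gs"
    by (simp add: d5_gens_def d5_coords_def Let_def gs iso_extendingD[OF \<Phi>] hom_simps)
qed

text \<open>
  Each generator fixes the denominator in its formula and changes the sign of the numerator. So the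
  formula is its own inverse, and \<open>d5_iso_sending\<close> applies with \<open>\<psi> = \<phi>\<close>.
\<close>

lemma s0_images:
  "iso_extending s\<^sub>0 (var(Vx := var Vx + \<alpha>0 / (var Vy + var Vt), V\<alpha>2 := var V\<alpha>2 + \<alpha>0))"
  (is "iso_extending _ ?\<phi>")
proof -
  have "specializes const ?\<phi> (?\<phi> v) (var v)" for v
    by (cases v; simp; rule const_scalar.specializes_eq)
      (rule const_scalar.specializes_intros |
        simp add: nonzero add_divide_distrib diff_divide_distrib algebra_simps)+
  then show ?thesis
    unfolding s\<^sub>0_def d5_transformation_def
    by (intro d5_iso_sending[where \<phi> = ?\<phi> and \<psi> = ?\<phi>])
      (simp_all add: d5_coords_def Let_def algebra_simps)
qed

lemma s1_images:
  "iso_extending s\<^sub>1 (var(Vx := var Vx + var V\<alpha>1 / var Vy, V\<alpha>1 := - var V\<alpha>1,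
      V\<alpha>2 := var V\<alpha>2 + var V\<alpha>1))"
  (is "iso_extending _ ?\<phi>")
proof -
  have "specializes const ?\<phi> (?\<phi> v) (var v)" for v
    by (cases v; simp; rule const_scalar.specializes_eq)
      (rule const_scalar.specializes_intros |
        simp add: nonzero add_divide_distrib diff_divide_distrib algebra_simps)+
  then show ?thesis
    unfolding s\<^sub>1_def d5_transformation_def
    by (intro d5_iso_sending[where \<phi> = ?\<phi> and \<psi> = ?\<phi>])
      (simp_all add: d5_coords_def Let_def algebra_simps)
qed

lemma s2_images:
  "iso_extending s\<^sub>2 (var(Vy := var Vy - var V\<alpha>2 / (var Vx - var Vz),
      Vw := var Vw + var V\<alpha>2 / (var Vx - var Vz), V\<alpha>1 := var V\<alpha>1 + var V\<alpha>2,
      V\<alpha>2 := - var V\<alpha>2, V\<alpha>3 := var V\<alpha>3 + var V\<alpha>2))"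
  (is "iso_extending _ ?\<phi>")
proof -
  have "specializes const ?\<phi> (?\<phi> v) (var v)" for v
    by (cases v; simp; rule const_scalar.specializes_eq)
      (rule const_scalar.specializes_intros |
        simp add: nonzero add_divide_distrib diff_divide_distrib algebra_simps)+
  then show ?thesis
    unfolding s\<^sub>2_def d5_transformation_def
    by (intro d5_iso_sending[where \<phi> = ?\<phi> and \<psi> = ?\<phi>])
      (simp_all add: d5_coords_def Let_def algebra_simps)
qed

lemma s3_images:
  "iso_extending s\<^sub>3 (var(Vz := var Vz + var V\<alpha>3 / var Vw,
      V\<alpha>2 := var V\<alpha>2 + var V\<alpha>3, V\<alpha>3 := - var V\<alpha>3,
      V\<alpha>4 := var V\<alpha>4 + var V\<alpha>3, V\<alpha>5 := var V\<alpha>5 + var V\<alpha>3))"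
  (is "iso_extending _ ?\<phi>")
proof -
  have "specializes const ?\<phi> (?\<phi> v) (var v)" for v
    by (cases v; simp; rule const_scalar.specializes_eq)
      (rule const_scalar.specializes_intros |
        simp add: nonzero add_divide_distrib diff_divide_distrib algebra_simps)+
  then show ?thesis
    unfolding s\<^sub>3_def d5_transformation_def
    by (intro d5_iso_sending[where \<phi> = ?\<phi> and \<psi> = ?\<phi>])
      (simp_all add: d5_coords_def Let_def algebra_simps)
qed

lemma s4_images:
  "iso_extending s\<^sub>4 (var(Vw := var Vw - var V\<alpha>4 / (var Vz - 1),
      V\<alpha>3 := var V\<alpha>3 + var V\<alpha>4, V\<alpha>4 := - var V\<alpha>4))"
  (is "iso_extending _ ?\<phi>")
proof -
  have "specializes const ?\<phi> (?\<phi> v) (var v)" for v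
    by (cases v; simp; rule const_scalar.specializes_eq)
      (rule const_scalar.specializes_intros |
        simp add: nonzero add_divide_distrib diff_divide_distrib algebra_simps)+
  then show ?thesis
    unfolding s\<^sub>4_def d5_transformation_def
    by (intro d5_iso_sending[where \<phi> = ?\<phi> and \<psi> = ?\<phi>])
      (simp_all add: d5_coords_def Let_def algebra_simps)
qed

lemma s5_images:
  "iso_extending s\<^sub>5 (var(Vw := var Vw - var V\<alpha>5 / var Vz,
      V\<alpha>3 := var V\<alpha>3 + var V\<alpha>5, V\<alpha>5 := - var V\<alpha>5))"
  (is "iso_extending _ ?\<phi>")
proof -
  have "specializes const ?\<phi> (?\<phi> v) (var v)" for v
    by (cases v; simp; rule const_scalar.specializes_eq)
      (rule const_scalar.specializes_intros |
        simp add: nonzero add_divide_distrib diff_divide_distrib algebra_simps)+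
  then show ?thesis
    unfolding s\<^sub>5_def d5_transformation_def
    by (intro d5_iso_sending[where \<phi> = ?\<phi> and \<psi> = ?\<phi>])
      (simp_all add: d5_coords_def Let_def algebra_simps)
qed


section \<open>The generators of the group of type B4\<close>

abbreviation A0 :: "b4var ratfun" where
  "A0 \<equiv> 1 - var VA1 - 2 * var VA2 - 2 * var VA3 - 2 * var VA4"

lemma range_var_subset_b4_gens: "range var \<subseteq> set b4_gens"
proof
  fix f :: "b4var ratfun" assume "f \<in> range var"
  then obtain v where "f = var v" by blast
  then show "f \<in> set b4_gens"
    by (cases v) (simp_all add: b4_gens_def b4_coords_def Let_def)
qed

lemma b4_transformation_images:
  fixes \<phi> :: "b4var \<Rightarrow> b4var ratfun"
  assumes "\<And>v. specializes const \<phi> (\<phi> v) (var v)"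
    and F: "b4_coords var F = [\<phi> VX, \<phi> VY, \<phi> VZ, \<phi> VW, \<phi> VT,
      1 - \<phi> VA1 - 2 * \<phi> VA2 - 2 * \<phi> VA3 - 2 * \<phi> VA4, \<phi> VA1, \<phi> VA2, \<phi> VA3, \<phi> VA4]"
  shows "iso_extending (b4_transformation F) \<phi>"
  unfolding b4_transformation_def
proof (rule iso_extending_iso_sending[OF assms(1,1) range_var_subset_b4_gens])
  fix \<Phi> assume \<Phi>: "iso_extending \<Phi> \<phi>"
  then interpret function_field_hom \<Phi> by (rule iso_extendingD)
  show "map \<Phi> b4_gens = b4_coords var F"
    unfolding F by (simp add: b4_gens_def b4_coords_def Let_def iso_extendingD[OF \<Phi>] hom_simps)
qed

lemma \<sigma>0_images:
  "iso_extending \<sigma>\<^sub>0 (var(VX := var VX + A0 / (var VY - 1), VA2 := var VA2 + A0))"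
  (is "iso_extending _ ?\<phi>")
proof -
  have "specializes const ?\<phi> (?\<phi> v) (var v)" for v
    by (cases v; simp; rule const_scalar.specializes_eq)
      (rule const_scalar.specializes_intros |
        simp add: nonzero add_divide_distrib diff_divide_distrib algebra_simps)+
  then show ?thesis
    unfolding \<sigma>\<^sub>0_def
    by (intro b4_transformation_images[where \<phi> = ?\<phi>])
      (simp_all add: b4_coords_def Let_def algebra_simps)
qed

lemma \<sigma>1_images:
  "iso_extending \<sigma>\<^sub>1 (var(VX := var VX + var VA1 / var VY, VA1 := - var VA1, VA2 := var VA2 + var VA1))"
  (is "iso_extending _ ?\<phi>")
proof -
  have "specializes const ?\<phi> (?\<phi> v) (var v)" for v
    by (cases v; simp; rule const_scalar.specializes_eq)
      (rule const_scalar.specializes_intros |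
        simp add: nonzero add_divide_distrib diff_divide_distrib algebra_simps)+
  then show ?thesis
    unfolding \<sigma>\<^sub>1_def
    by (intro b4_transformation_images[where \<phi> = ?\<phi>])
      (simp_all add: b4_coords_def Let_def algebra_simps)
qed

lemma \<sigma>2_images:
  "iso_extending \<sigma>\<^sub>2 (var(VY := var VY - var VA2 / (var VX - var VZ),
      VW := var VW + var VA2 / (var VX - var VZ), VA1 := var VA1 + var VA2,
      VA2 := - var VA2, VA3 := var VA3 + var VA2))"
  (is "iso_extending _ ?\<phi>")
proof -
  have "specializes const ?\<phi> (?\<phi> v) (var v)" for v
    by (cases v; simp; rule const_scalar.specializes_eq)
      (rule const_scalar.specializes_intros |
        simp add: nonzero add_divide_distrib diff_divide_distrib algebra_simps)+
  then show ?thesis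
    unfolding \<sigma>\<^sub>2_def
    by (intro b4_transformation_images[where \<phi> = ?\<phi>])
      (simp_all add: b4_coords_def Let_def algebra_simps)
qed

lemma \<sigma>3_images:
  "iso_extending \<sigma>\<^sub>3 (var(VZ := var VZ + var VA3 / var VW, VA2 := var VA2 + var VA3,
      VA3 := - var VA3, VA4 := var VA4 + var VA3))"
  (is "iso_extending _ ?\<phi>")
proof -
  have "specializes const ?\<phi> (?\<phi> v) (var v)" for v
    by (cases v; simp; rule const_scalar.specializes_eq)
      (rule const_scalar.specializes_intros |
        simp add: nonzero add_divide_distrib diff_divide_distrib algebra_simps)+
  then show ?thesis
    unfolding \<sigma>\<^sub>3_def
    by (intro b4_transformation_images[where \<phi> = ?\<phi>])
      (simp_all add: b4_coords_def Let_def algebra_simps)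
qed

lemma \<sigma>4_images:
  "iso_extending \<sigma>\<^sub>4 (var(VW := var VW - 2 * var VA4 / var VZ + var VT / var VZ ^ 2, VT := - var VT,
      VA3 := var VA3 + 2 * var VA4, VA4 := - var VA4))"
  (is "iso_extending _ ?\<phi>")
proof -
  have "specializes const ?\<phi> (?\<phi> v) (var v)" for v
    by (cases v; simp; rule const_scalar.specializes_eq)
      (rule const_scalar.specializes_intros |
        simp add: nonzero add_divide_distrib diff_divide_distrib algebra_simps)+
  then show ?thesis
    unfolding \<sigma>\<^sub>4_def
    by (intro b4_transformation_images[where \<phi> = ?\<phi>])
      (simp_all add: b4_coords_def Let_def algebra_simps)
qed


section \<open>The degeneration and the induced actions\<close>

abbreviation \<epsilon> :: "b4var option ratfun" where "\<epsilon> \<equiv> var None"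

abbreviation evar :: "b4var \<Rightarrow> b4var option ratfun" where "evar u \<equiv> var (Some u)"

text \<open>
  The change of variables and its inverse. The latter is found from \<open>\<epsilon> = 1 / \<alpha>\<^sub>5\<close> and
  \<open>\<epsilon> T = - t\<close>. As all the generators fix \<open>t\<close>, they act on \<open>X\<close>, \<open>Y\<close>, \<open>Z\<close>, \<open>W\<close> as on
  \<open>x\<close>, \<open>y\<close>, \<open>z\<close>, \<open>w\<close> up to a constant rescaling and a shift.
\<close>

primrec old_in_new :: "d5var \<Rightarrow> b4var option ratfun" where
  "old_in_new Vx = 1 + evar VX / (\<epsilon> * evar VT)"
| "old_in_new Vy = \<epsilon> * evar VT * evar VY"
| "old_in_new Vz = 1 + evar VZ / (\<epsilon> * evar VT)"
| "old_in_new Vw = \<epsilon> * evar VT * evar VW"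
| "old_in_new Vt = - \<epsilon> * evar VT"
| "old_in_new V\<alpha>1 = evar VA1"
| "old_in_new V\<alpha>2 = evar VA2"
| "old_in_new V\<alpha>3 = evar VA3"
| "old_in_new V\<alpha>4 = 2 * evar VA4 - 1 / \<epsilon>"
| "old_in_new V\<alpha>5 = 1 / \<epsilon>"

fun new_in_old :: "b4var option \<Rightarrow> d5var ratfun" where
  "new_in_old None = 1 / var V\<alpha>5"
| "new_in_old (Some VX) = - var Vt * (var Vx - 1)"
| "new_in_old (Some VY) = - var Vy / var Vt"
| "new_in_old (Some VZ) = - var Vt * (var Vz - 1)"
| "new_in_old (Some VW) = - var Vw / var Vt"
| "new_in_old (Some VT) = - var Vt * var V\<alpha>5"
| "new_in_old (Some VA1) = var V\<alpha>1"
| "new_in_old (Some VA2) = var V\<alpha>2"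
| "new_in_old (Some VA3) = var V\<alpha>3"
| "new_in_old (Some VA4) = (var V\<alpha>4 + var V\<alpha>5) / 2"

lemma specializes_old_in_new: "specializes const new_in_old (old_in_new v) (var v)"
  by (cases v; simp; rule const_scalar.specializes_eq)
    (rule const_scalar.specializes_intros | simp add: nonzero add_divide_distrib)+

lemma specializes_new_in_old: "specializes const old_in_new (new_in_old w) (var w)"
  by (cases w rule: new_in_old.cases; simp; rule const_scalar.specializes_eq)
    (rule const_scalar.specializes_intros | simp add: nonzero)+

lemma iso_extending_degeneration: "iso_extending degeneration old_in_new"
  unfolding degeneration_def
  by (rule d5_iso_sending[OF specializes_old_in_new specializes_new_in_old])
    (simp add: b4_coords_def Let_def)

lemmas degenerationD = iso_extendingD[OF iso_extending_degeneration]

interpretation degeneration: function_field_hom degeneration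
  by (rule degenerationD)

lemma degeneration_new_in_old: "degeneration (new_in_old w) = var w"
  using degeneration.specializes_hom[of "new_in_old w"] specializes_new_in_old[of w]
  by (auto simp: degenerationD(4) intro: const_scalar.specializes_unique)

lemma induced_action_var: "induced_action S (var w) = degeneration (S (new_in_old w))"
proof -
  have "inv_into UNIV degeneration (var w) = new_in_old w"
    using degeneration_new_in_old[of w] degenerationD(3) by (simp add: bij_is_inj inv_f_eq)
  then show ?thesis by (simp add: induced_action_def)
qed

lemma hom_induced_action:
  assumes "function_field_hom S"
  shows "function_field_hom (induced_action S)"
proof -
  interpret S: function_field_hom S by fact
  have inj: "inv_into UNIV degeneration f = g" if "degeneration g = f" for f g
    using that degenerationD(3) by (simp add: bij_is_inj inv_f_eq)
  have surj: "degeneration (inv_into UNIV degeneration f) = f" for f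
    using degenerationD(3) by (simp add: bij_is_surj surj_f_inv_f)
  have "function_field_hom (inv_into UNIV degeneration)"
    by standard (simp_all add: inj surj degeneration.hom_simps)
  then interpret I: function_field_hom "inv_into UNIV degeneration" .
  show ?thesis
    by standard (simp_all add: induced_action_def S.hom_simps degeneration.hom_simps I.hom_simps)
qed

text \<open>
  Limits have to be computed for the nine variables only: specialization at \<open>\<epsilon> = 0\<close> is compatible
  with the field operations, so the limit for the eliminated parameter follows.
\<close>

lemma action_tends_toI:
  assumes "function_field_hom S" "function_field_hom \<sigma>"
    and lim: "\<And>u. specializes const (case_option 0 var) (induced_action S (evar u)) (\<sigma> (var u))"
  shows "action_tends_to S \<sigma>"
proof -
  interpret I: function_field_hom "induced_action S"
    by (rule hom_induced_action) fact
  interpret \<sigma>: function_field_hom \<sigma> by fact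
  have "specializes const (case_option 0 var)
      (induced_action S (1 - evar VA1 - 2 * evar VA2 - 2 * evar VA3 - 2 * evar VA4)) (\<sigma> A0)"
    unfolding I.hom_simps \<sigma>.hom_simps by (intro const_scalar.specializes_intros lim)
  then show ?thesis
    unfolding action_tends_to_def eps_gens_def b4_gens_def b4_coords_def Let_def
    by (simp add: specializes_imp_tends lim)
qed

abbreviation eA0 :: "b4var option ratfun" where
  "eA0 \<equiv> 1 - evar VA1 - 2 * evar VA2 - 2 * evar VA3 - 2 * evar VA4"

text \<open>
  The actions of the first three generators on the new variables are free of \<open>\<epsilon>\<close> and have the same
  formulas as \<open>\<sigma>\<^sub>0\<close>, \<open>\<sigma>\<^sub>1\<close> and \<open>\<sigma>\<^sub>2\<close>.
\<close>

lemma action_s0: "action_tends_to s\<^sub>0 \<sigma>\<^sub>0"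
proof -
  interpret function_field_hom s\<^sub>0
    by (rule iso_extendingD[OF s0_images])
  have "function_field_hom \<sigma>\<^sub>0"
    by (rule iso_extendingD[OF \<sigma>0_images])
  moreover have "function_field_hom s\<^sub>0"
    ..
  moreover have action: "induced_action s\<^sub>0 (evar u) =
      (evar(VX := evar VX + eA0 / (evar VY - 1), VA2 := evar VA2 + eA0)) u" for u
    by (cases u) (simp_all add: induced_action_var degenerationD(4) iso_extendingD(4)[OF s0_images] hom_simps
        degeneration.hom_simps nonzero field_simps power2_eq_square)
  have "specializes const (case_option 0 var) (induced_action s\<^sub>0 (evar u)) (\<sigma>\<^sub>0 (var u))" for u
    unfolding action
    by (cases u; simp add: iso_extendingD(4)[OF \<sigma>0_images]; rule const_scalar.specializes_eq)
      (rule const_scalar.specializes_intros | simp add: nonzero power2_eq_square)+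
  ultimately show ?thesis
    by (intro action_tends_toI)
qed

lemma action_s1: "action_tends_to s\<^sub>1 \<sigma>\<^sub>1"
proof -
  interpret function_field_hom s\<^sub>1
    by (rule iso_extendingD[OF s1_images])
  have "function_field_hom \<sigma>\<^sub>1"
    by (rule iso_extendingD[OF \<sigma>1_images])
  moreover have "function_field_hom s\<^sub>1"
    ..
  moreover have action: "induced_action s\<^sub>1 (evar u) =
      (evar(VX := evar VX + evar VA1 / evar VY, VA1 := - evar VA1, VA2 := evar VA2 + evar VA1)) u" for u
    by (cases u) (simp_all add: induced_action_var degenerationD(4) iso_extendingD(4)[OF s1_images] hom_simps
        degeneration.hom_simps nonzero field_simps power2_eq_square)
  have "specializes const (case_option 0 var) (induced_action s\<^sub>1 (evar u)) (\<sigma>\<^sub>1 (var u))" for u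
    unfolding action
    by (cases u; simp add: iso_extendingD(4)[OF \<sigma>1_images]; rule const_scalar.specializes_eq)
      (rule const_scalar.specializes_intros | simp add: nonzero power2_eq_square)+
  ultimately show ?thesis
    by (intro action_tends_toI)
qed

lemma action_s2: "action_tends_to s\<^sub>2 \<sigma>\<^sub>2"
proof -
  interpret function_field_hom s\<^sub>2
    by (rule iso_extendingD[OF s2_images])
  have "function_field_hom \<sigma>\<^sub>2"
    by (rule iso_extendingD[OF \<sigma>2_images])
  moreover have "function_field_hom s\<^sub>2"
    ..
  moreover have action: "induced_action s\<^sub>2 (evar u) =
      (evar(VY := evar VY - evar VA2 / (evar VX - evar VZ),
      VW := evar VW + evar VA2 / (evar VX - evar VZ), VA1 := evar VA1 + evar VA2,
      VA2 := - evar VA2, VA3 := evar VA3 + evar VA2)) u" for u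
    by (cases u) (simp_all add: induced_action_var degenerationD(4) iso_extendingD(4)[OF s2_images] hom_simps
        degeneration.hom_simps nonzero field_simps power2_eq_square)
  have "specializes const (case_option 0 var) (induced_action s\<^sub>2 (evar u)) (\<sigma>\<^sub>2 (var u))" for u
    unfolding action
    by (cases u; simp add: iso_extendingD(4)[OF \<sigma>2_images]; rule const_scalar.specializes_eq)
      (rule const_scalar.specializes_intros | simp add: nonzero power2_eq_square)+
  ultimately show ?thesis
    by (intro action_tends_toI)
qed

text \<open>
  Here \<open>\<epsilon>\<close> enters: \<open>1 / \<epsilon> = \<alpha>\<^sub>5\<close> is shifted by \<open>\<alpha>\<^sub>3 = A\<^sub>3\<close> while \<open>t = - \<epsilon> T\<close> stays fixed, so
  \<open>T\<close> is multiplied by \<open>1 + \<epsilon> A\<^sub>3\<close>, which tends to \<open>1\<close>.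
\<close>

lemma action_s3: "action_tends_to s\<^sub>3 \<sigma>\<^sub>3"
proof -
  interpret function_field_hom s\<^sub>3
    by (rule iso_extendingD[OF s3_images])
  have "function_field_hom \<sigma>\<^sub>3"
    by (rule iso_extendingD[OF \<sigma>3_images])
  moreover have "function_field_hom s\<^sub>3"
    ..
  moreover have action: "induced_action s\<^sub>3 (evar u) =
      (evar(VZ := evar VZ + evar VA3 / evar VW, VT := evar VT * (1 + \<epsilon> * evar VA3),
      VA2 := evar VA2 + evar VA3, VA3 := - evar VA3, VA4 := evar VA4 + evar VA3)) u" for u
    by (cases u) (simp_all add: induced_action_var degenerationD(4) iso_extendingD(4)[OF s3_images] hom_simps
        degeneration.hom_simps nonzero field_simps power2_eq_square)
  have "specializes const (case_option 0 var) (induced_action s\<^sub>3 (evar u)) (\<sigma>\<^sub>3 (var u))" for u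
    unfolding action
    by (cases u; simp add: iso_extendingD(4)[OF \<sigma>3_images]; rule const_scalar.specializes_eq)
      (rule const_scalar.specializes_intros | simp add: nonzero power2_eq_square)+
  ultimately show ?thesis
    by (intro action_tends_toI)
qed

text \<open>
  Up to sign, the residues \<open>2 A\<^sub>4 - 1 / \<epsilon>\<close> and \<open>1 / \<epsilon>\<close> of the two simple poles that \<open>s\<^sub>4 s\<^sub>5\<close> gives to \<open>w\<close>, at
  \<open>z = 1\<close> and \<open>z = 0\<close>, diverge with opposite signs. In the new variables these poles are at
  \<open>Z = 0\<close> and \<open>Z = - \<epsilon> T\<close>. The difference quotient
  \<open>(1 / \<epsilon>) (1 / Z - 1 / (Z + \<epsilon> T)) = T / (Z (Z + \<epsilon> T))\<close> is finite at \<open>\<epsilon> = 0\<close>, where the poles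
  merge into the double pole \<open>T / Z\<^sup>2\<close> of \<open>\<sigma>\<^sub>4\<close>.
\<close>

lemma confluence_identity:
  fixes e t z w a :: "'k::field"
  assumes "e \<noteq> 0" "t \<noteq> 0" "z \<noteq> 0" "z + e * t \<noteq> 0"
  shows "- (e * t * w - (2 * a - 1 / e) / (1 + z / (e * t) - 1) - (1 / e) / (1 + z / (e * t))) / (- e * t)
    = w - 2 * a / z + t / (z * (z + e * t))"
proof -
  have 1: "1 + z / (e * t) - 1 = z / (e * t)" and 2: "1 + z / (e * t) = (z + e * t) / (e * t)"
    using assms by (simp_all add: field_simps)
  have "- (e * t * w - (2 * a - 1 / e) / (1 + z / (e * t) - 1) - (1 / e) / (1 + z / (e * t))) / (- e * t)
      = w - (2 * a - 1 / e) / z - (1 / e) / (z + e * t)"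
    unfolding 1 unfolding 2 using assms(1-3) by (simp add: diff_divide_distrib)
  also have "\<dots> = w - 2 * a / z + (1 / e) * (1 / z - 1 / (z + e * t))"
    by (simp add: algebra_simps diff_divide_distrib)
  also have "1 / z - 1 / (z + e * t) = e * t / (z * (z + e * t))"
    using assms by (simp add: diff_frac_eq)
  finally show ?thesis
    using assms(1) by simp
qed

lemma var_add_eps_nonzero: "evar VZ + \<epsilon> * evar VT \<noteq> 0"
  by (rule specializes_nonzero[of "\<lambda>_. 1"], (rule complex_scalar.specializes_intros)+) simp

text \<open>
  Neither \<open>s\<^sub>4\<close> nor \<open>s\<^sub>5\<close> alone has a limit: \<open>s\<^sub>5\<close> sends \<open>A\<^sub>4\<close> to \<open>A\<^sub>4 - 1 / \<epsilon>\<close> and \<open>s\<^sub>4\<close> sends it to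
  \<open>- A\<^sub>4 + 1 / \<epsilon>\<close>. The product changes the signs of \<open>\<alpha>\<^sub>4\<close> and
  \<open>\<alpha>\<^sub>5\<close>, hence those of \<open>A\<^sub>4 = (\<alpha>\<^sub>4 + \<alpha>\<^sub>5) / 2\<close>, of \<open>\<epsilon>\<close> and, as \<open>t\<close> is fixed, of \<open>T\<close>.
\<close>

lemma action_s4s5: "action_tends_to (s\<^sub>4 \<circ> s\<^sub>5) \<sigma>\<^sub>4"
proof -
  interpret s4: function_field_hom s\<^sub>4
    by (rule iso_extendingD[OF s4_images])
  interpret s5: function_field_hom s\<^sub>5
    by (rule iso_extendingD[OF s5_images])
  have "function_field_hom \<sigma>\<^sub>4"
    by (rule iso_extendingD[OF \<sigma>4_images])
  moreover have "function_field_hom (s\<^sub>4 \<circ> s\<^sub>5)"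
    by standard (simp_all add: s4.hom_simps s5.hom_simps)
  moreover have action: "induced_action (s\<^sub>4 \<circ> s\<^sub>5) (evar u) =
      (evar(VW := evar VW - 2 * evar VA4 / evar VZ + evar VT / (evar VZ * (evar VZ + \<epsilon> * evar VT)),
      VT := - evar VT, VA3 := evar VA3 + 2 * evar VA4, VA4 := - evar VA4)) u" for u
  proof (cases "u = VW")
    case True
    have "(s\<^sub>4 \<circ> s\<^sub>5) (new_in_old (Some VW)) =
        - (var Vw - var V\<alpha>4 / (var Vz - 1) - var V\<alpha>5 / var Vz) / var Vt"
      by (simp add: iso_extendingD(4)[OF s4_images] iso_extendingD(4)[OF s5_images]
          s4.hom_simps s5.hom_simps diff_divide_distrib)
    then have "induced_action (s\<^sub>4 \<circ> s\<^sub>5) (evar VW) =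
        - (\<epsilon> * evar VT * evar VW - (2 * evar VA4 - 1 / \<epsilon>) / (1 + evar VZ / (\<epsilon> * evar VT) - 1)
          - (1 / \<epsilon>) / (1 + evar VZ / (\<epsilon> * evar VT))) / (- \<epsilon> * evar VT)"
      by (simp only: induced_action_var degeneration.hom_simps degenerationD(4) old_in_new.simps)
    also have "\<dots> = evar VW - 2 * evar VA4 / evar VZ
        + evar VT / (evar VZ * (evar VZ + \<epsilon> * evar VT))"
      by (intro confluence_identity var_nonzero var_add_eps_nonzero)
    finally show ?thesis
      using True by simp
  next
    case False
    then show ?thesis
      by (cases u) (simp_all add: induced_action_var degenerationD(4) iso_extendingD(4)[OF s4_images]
        iso_extendingD(4)[OF s5_images] s4.hom_simps s5.hom_simps degeneration.hom_simps
        nonzero field_simps)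
  qed
  have "specializes const (case_option 0 var) (induced_action (s\<^sub>4 \<circ> s\<^sub>5) (evar u)) (\<sigma>\<^sub>4 (var u))" for u
    unfolding action
    by (cases u; simp add: iso_extendingD(4)[OF \<sigma>4_images]; rule const_scalar.specializes_eq)
      (rule const_scalar.specializes_intros | simp add: nonzero power2_eq_square)+
  ultimately show ?thesis
    by (intro action_tends_toI)
qed


section \<open>The subgroup\<close>

lemma iso_in_BijGroup: "function_field_iso \<Phi> \<Longrightarrow> \<Phi> \<in> carrier (BijGroup UNIV)"
  by (simp add: BijGroup_def Bij_def function_field_iso_iff)

lemma carrier_W_D5_subgroup: "subgroup (carrier W_D5) (BijGroup UNIV)"
  unfolding W_D5_def
  using s0_images s1_images s2_images s3_images s4_images s5_images
  by (simp add: group.generate_is_subgroup group_BijGroup iso_in_BijGroup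
      iso_extendingD(1))

lemma group_W_D5: "group W_D5"
  using subgroup.subgroup_is_group[OF carrier_W_D5_subgroup group_BijGroup]
  by (simp add: W_D5_def)

lemma generators_in_W_D5: "{s\<^sub>0, s\<^sub>1, s\<^sub>2, s\<^sub>3, s\<^sub>4 \<circ> s\<^sub>5} \<subseteq> carrier W_D5"
proof -
  have incl: "{s\<^sub>0, s\<^sub>1, s\<^sub>2, s\<^sub>3, s\<^sub>4, s\<^sub>5} \<subseteq> carrier W_D5"
    by (auto simp: W_D5_def intro: generate.incl)
  have "s\<^sub>4 \<otimes>\<^bsub>BijGroup UNIV\<^esub> s\<^sub>5 \<in> carrier W_D5"
    using incl by (intro subgroup.m_closed[OF carrier_W_D5_subgroup]) auto
  moreover have "s\<^sub>4 \<otimes>\<^bsub>BijGroup UNIV\<^esub> s\<^sub>5 = s\<^sub>4 \<circ> s\<^sub>5"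
    using iso_extendingD(3)[OF s4_images] iso_extendingD(3)[OF s5_images]
    by (auto simp: BijGroup_def Bij_def compose_def fun_eq_iff)
  ultimately show ?thesis using incl by auto
qed

theorem theorem3p4:
  shows "\<exists>H. subgroup H W_D5 \<and> converges_to_W_B4 H"
proof (intro exI conjI)
  show "subgroup (generate W_D5 {s\<^sub>0, s\<^sub>1, s\<^sub>2, s\<^sub>3, s\<^sub>4 \<circ> s\<^sub>5}) W_D5"
    by (intro group.generate_is_subgroup group_W_D5 generators_in_W_D5)
  show "converges_to_W_B4 (generate W_D5 {s\<^sub>0, s\<^sub>1, s\<^sub>2, s\<^sub>3, s\<^sub>4 \<circ> s\<^sub>5})"
    unfolding converges_to_W_B4_def
    using action_s0 action_s1 action_s2 action_s3 action_s4s5 by blast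
qed

end
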